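(* Let $S$ be a $*$-monoid, let $a,d\in S$ satisfy $(ad)^{*}=ad$ and $(da)^{*}=da$, and let $k\geq 1$ be an integer. Then the following conditions are equivalent: (1) $a$ is invertible along $d$, and $d$ is group invertible; (2) $a$ is invertible along $d$, and $d$ is both group invertible and Moore--Penrose invertible; (3) $(ad)^{k}$ is right invertible along $d$ and $(da)^{k}$ is left invertible along $d$; (4) $(ad)^{k}$ is invertible along $d$; (5) $(da)^{k}$ is invertible along $d$.
   Context: A $*$-monoid is a monoid $S$ with an involution, i.e. a map $*:S\to S$ with $(a^{*})^{*}=a$ and $(ab)^{*}=b^{*}a^{*}$ for all $a,b\in S$. For $a,d\in S$: $a$ is invertible along $d$ if there exists $b\in S$ with $bad=d=dab$, $bS\subseteq dS$, $Sb\subseteq Sd$. $a$ is left invertible along $d$ if there exists $b\in S$ with $bad=d$ and $Sb\subseteq Sd$; $a$ is right invertible along $d$ if there exists $b\in S$ with $dab=d$ and $bS\subseteq dS$. An element $a\in S$ is group invertible if there is $x\in S$ with $axa=a$, $xax=x$, $ax=xa$. An element $a\in S$ is Moore--Penrose invertible if there is $x\in S$ with $axa=a$, $xax=x$, $(ax)^{*}=ax$, $(xa)^{*}=xa$. *)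

theory Defs
  imports Main
begin

class star_monoid = monoid_mult +
  fixes star :: "'a \<Rightarrow> 'a"
  assumes star_star: "star (star a) = a"
    and star_mult: "star (a * b) = star b * star a"

context monoid_mult
begin

definition right_ideal :: "'a \<Rightarrow> 'a set"  (* b S *)
  where "right_ideal b = {b * s | s. True}"

definition left_ideal :: "'a \<Rightarrow> 'a set"  (* S b *)
  where "left_ideal b = {s * b | s. True}"

definition invertible_along :: "'a \<Rightarrow> 'a \<Rightarrow> bool"
  where "invertible_along a d \<longleftrightarrow>
    (\<exists>b. b * a * d = d \<and> d = d * a * b \<and>
         right_ideal b \<subseteq> right_ideal d \<and> left_ideal b \<subseteq> left_ideal d)"

definition left_invertible_along :: "'a \<Rightarrow> 'a \<Rightarrow> bool"
  where "left_invertible_along a d \<longleftrightarrow>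
    (\<exists>b. b * a * d = d \<and> left_ideal b \<subseteq> left_ideal d)"

definition right_invertible_along :: "'a \<Rightarrow> 'a \<Rightarrow> bool"
  where "right_invertible_along a d \<longleftrightarrow>
    (\<exists>b. d * a * b = d \<and> right_ideal b \<subseteq> right_ideal d)"

definition group_invertible :: "'a \<Rightarrow> bool"
  where "group_invertible a \<longleftrightarrow>
    (\<exists>x. a * x * a = a \<and> x * a * x = x \<and> a * x = x * a)"

end

definition (in star_monoid) moore_penrose_invertible :: "'a \<Rightarrow> bool"
  where "moore_penrose_invertible a \<longleftrightarrow>
    (\<exists>x. a * x * a = a \<and> x * a * x = x \<and> star (a * x) = a * x \<and> star (x * a) = x * a)"

end

theory Submission
  imports Defs
begin

text \<open>
  Write \<open>q = d a\<close> and \<open>p = a d\<close>. If \<open>d \<in> d a d S\<close> then \<open>q \<in> q\<^sup>2 S\<close>; as \<open>q\<close> is self-adjoint,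
  it has a self-adjoint group inverse \<open>g\<close>, and \<open>q g d = d\<close>. Then \<open>p\<close> also has a
  self-adjoint group inverse \<open>h\<close>, with \<open>d p h = d\<close> and \<open>g d = d h\<close>. Hence left, right and
  two-sided invertibility of \<open>a\<close> along \<open>d\<close> coincide, and \<open>a g\<close> is the Moore--Penrose inverse
  of \<open>d\<close>. Since \<open>g d = d h\<close> and \<open>q d = d p\<close>, powers of \<open>p\<close> and \<open>q\<close> can be moved across \<open>d\<close> and
  cancelled, so that each of the remaining conditions reduces to \<open>d \<in> d\<^sup>2 S \<inter> S d\<^sup>2\<close>.
\<close>

section \<open>Ideal-free forms of invertibility, group inverses and intertwined powers\<close>

context monoid_mult
begin

lemma right_ideal_subset_iff: "right_ideal b \<subseteq> right_ideal d \<longleftrightarrow> (\<exists>x. b = d * x)"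
proof
  assume "right_ideal b \<subseteq> right_ideal d"
  moreover have "b * 1 \<in> right_ideal b" unfolding right_ideal_def by blast
  ultimately show "\<exists>x. b = d * x" unfolding right_ideal_def by auto
next
  assume "\<exists>x. b = d * x"
  then show "right_ideal b \<subseteq> right_ideal d"
    unfolding right_ideal_def using mult.assoc by fastforce
qed

lemma left_ideal_subset_iff: "left_ideal b \<subseteq> left_ideal d \<longleftrightarrow> (\<exists>x. b = x * d)"
proof
  assume "left_ideal b \<subseteq> left_ideal d"
  moreover have "1 * b \<in> left_ideal b" unfolding left_ideal_def by blast
  ultimately show "\<exists>x. b = x * d" unfolding left_ideal_def by auto
next
  assume "\<exists>x. b = x * d"
  then show "left_ideal b \<subseteq> left_ideal d"
    unfolding left_ideal_def by (auto simp: mult.assoc[symmetric])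
qed

text \<open>Writing the witness as \<open>b = d * x\<close> removes the ideals; later arguments work
  with equations of this kind.\<close>

lemma right_invertible_along_iff: "right_invertible_along a d \<longleftrightarrow> (\<exists>x. d * a * d * x = d)"
  unfolding right_invertible_along_def right_ideal_subset_iff by (auto simp: mult.assoc)

lemma left_invertible_along_iff: "left_invertible_along a d \<longleftrightarrow> (\<exists>y. y * d * a * d = d)"
  unfolding left_invertible_along_def left_ideal_subset_iff by (metis mult.assoc)

lemma invertible_along_iff:
  "invertible_along a d \<longleftrightarrow> right_invertible_along a d \<and> left_invertible_along a d"
proof
  assume "invertible_along a d"
  then show "right_invertible_along a d \<and> left_invertible_along a d"
    unfolding invertible_along_def right_invertible_along_def left_invertible_along_def
    by metis
next
  assume "right_invertible_along a d \<and> left_invertible_along a d"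
  then obtain x y where x: "d * a * d * x = d" and y: "y * d * a * d = d"
    unfolding right_invertible_along_iff left_invertible_along_iff by blast
  \<comment> \<open>\<open>y * d * a * d * x\<close> collapses from either end, so the two one-sided
    witnesses coincide and give the two-sided one.\<close>
  have "y * d = y * (d * a * d * x)" by (simp only: x)
  also have "\<dots> = y * d * a * d * x" by (simp only: mult.assoc)
  finally have eq: "y * d = d * x" by (simp only: y)
  have "d * a * (d * x) = d" using x by (simp only: mult.assoc)
  moreover have "d * x * a * d = d" using y by (simp only: eq)
  ultimately show "invertible_along a d"
    unfolding invertible_along_def right_ideal_subset_iff left_ideal_subset_iff
    using eq by metis
qed

text \<open>Evaluating \<open>s * w * w * t\<close> both ways gives \<open>s * w = w * t\<close>.
  This common element is the idempotent belonging to the group inverse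
  \<open>s * w * t\<close>.\<close>

lemma group_inverse_from_sides:
  assumes r: "w * w * t = w" and l: "s * w * w = w"
  shows "w * (s * w * t) = s * w * t * w"
    and "w * (s * w * t) * w = w"
    and "s * w * t * w * (s * w * t) = s * w * t"
proof -
  have sw: "s * w = w * t"
    using arg_cong[OF r, of "\<lambda>z. s * z"] l by (simp add: mult.assoc[symmetric])
  have wg: "w * (s * w * t) = w * t"
    by (metis mult.assoc r sw)
  have gw: "s * w * t * w = w * t"
    by (metis mult.assoc l sw)
  show "w * (s * w * t) = s * w * t * w" by (simp only: wg gw)
  show "w * (s * w * t) * w = w" by (metis mult.assoc l sw wg)
  show "s * w * t * w * (s * w * t) = s * w * t" by (metis mult.assoc gw r sw)
qed

lemma group_invertible_iff:
  "group_invertible d \<longleftrightarrow> (\<exists>u. d * d * u = d) \<and> (\<exists>v. v * d * d = d)"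
proof
  assume "group_invertible d"
  then show "(\<exists>u. d * d * u = d) \<and> (\<exists>v. v * d * d = d)"
    unfolding group_invertible_def by (metis mult.assoc)
next
  assume "(\<exists>u. d * d * u = d) \<and> (\<exists>v. v * d * d = d)"
  then show "group_invertible d"
    unfolding group_invertible_def using group_inverse_from_sides by meson
qed

lemma power_intertwine: "u * d = d * v \<Longrightarrow> u ^ n * d = d * v ^ n"
  by (induction n) (simp, metis mult.assoc power_Suc power_Suc2)

text \<open>Carrying \<open>u ^ n\<close> across \<open>d\<close> as \<open>v ^ n\<close> brings the
  innermost \<open>w * u\<close> next to \<open>d\<close>, where it cancels.\<close>

lemma power_cancel:
  assumes "u * d = d * v" and "w * u * d = d"
  shows "w ^ n * u ^ n * d = d"
proof (induction n)
  case (Suc n)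
  have "w ^ Suc n * u ^ Suc n * d = w ^ n * (w * u * (u ^ n * d))"
    by (simp only: power_Suc2[of w] power_Suc[of u] mult.assoc)
  also have "\<dots> = w ^ n * (w * u * d * v ^ n)"
    by (simp only: power_intertwine[OF assms(1)] mult.assoc)
  also have "\<dots> = w ^ n * (u ^ n * d)"
    by (simp only: assms(2) power_intertwine[OF assms(1)])
  finally show ?case using Suc by (simp only: mult.assoc)
qed simp

end

section \<open>Self-adjoint group inverses and one-sided invertibility\<close>

context star_monoid
begin

text \<open>Applying \<open>star\<close> to \<open>w * w * t = w\<close> gives the mirror equation
  with \<open>s = star t\<close>, and \<open>star t * w * t\<close> is self-adjoint by its
  shape.\<close>

lemma selfadjoint_group_inverse:
  assumes w: "star w = w" and t: "w * w * t = w"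
  obtains g where "star g = g" "w * g = g * w" "w * g * w = w" "g * w * g = g"
proof
  have l: "star t * w * w = w"
    using arg_cong[OF t, of star] by (simp add: star_mult w mult.assoc)
  show "star (star t * w * t) = star t * w * t"
    by (simp add: star_mult star_star w mult.assoc)
  show "w * (star t * w * t) = star t * w * t * w"
    "w * (star t * w * t) * w = w"
    "star t * w * t * w * (star t * w * t) = star t * w * t"
    using group_inverse_from_sides[OF t l] by blast+
qed

lemma right_invertible_along_selfadjoint:
  assumes p: "star (a * d) = a * d" and q: "star (d * a) = d * a"
    and "right_invertible_along a d"
  obtains g h where "star (d * a * g) = d * a * g" "star (a * d * h) = a * d * h"
    "g * (d * a) * g = g" "d * a * g = g * (d * a)" "a * d * h = h * (a * d)"
    "d * a * g * d = d" "d * (a * d) * h = d" "g * d = d * h"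
proof -
  from assms(3) obtain x where x: "d * a * d * x = d"
    unfolding right_invertible_along_iff by blast
  \<comment> \<open>The factor \<open>d * x * x * a\<close> allows \<open>x\<close> to be applied
    twice, exhibiting \<open>d * a\<close> as a right multiple of its square.\<close>
  have "(d * a) * (d * a) * (d * x * x * a) = d * a * (d * a * d * x) * x * a"
    by (simp only: mult.assoc)
  also have "\<dots> = d * a" by (simp only: x)
  finally obtain g where g: "star g = g" "d * a * g = g * (d * a)"
      "d * a * g * (d * a) = d * a" "g * (d * a) * g = g"
    using selfadjoint_group_inverse[OF q] by metis
  have "d * a * g * d = d * a * g * (d * a * d * x)" by (simp only: x)
  also have "\<dots> = d * a * g * (d * a) * d * x" by (simp only: mult.assoc)
  finally have qgd: "d * a * g * d = d" by (simp only: g(3) x)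
  have gqd: "g * d * (a * d) = d"
    by (metis g(2) mult.assoc qgd)
  have qqgg: "d * (a * (d * (a * (g * (g * d))))) = d"
    by (metis g(2) mult.assoc qgd)
  \<comment> \<open>With \<open>q = d * a\<close>, the part after the leading \<open>a\<close> is
    \<open>q * q * g * g * d\<close>, which equals \<open>d\<close>.\<close>
  have "(a * d) * (a * d) * (a * g * g * d) = a * (d * (a * (d * (a * (g * (g * d))))))"
    by (simp only: mult.assoc)
  also have "\<dots> = a * d" by (simp only: qqgg)
  finally obtain h where h: "star h = h" "a * d * h = h * (a * d)"
      "a * d * h * (a * d) = a * d" "h * (a * d) * h = h"
    using selfadjoint_group_inverse[OF p] by metis
  \<comment> \<open>Replacing \<open>d\<close> by \<open>g * d * (a * d)\<close> encloses
    \<open>h\<close> between two copies of \<open>a * d\<close>, where it disappears.\<close>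
  have dhp: "d * h * (a * d) = d"
    by (metis gqd h(2,3) mult.assoc)
  have dph: "d * (a * d) * h = d"
    by (metis dhp h(2) mult.assoc)
  have "d * h = g * d * (a * d) * h" by (simp only: gqd)
  also have "\<dots> = g * (d * (a * d) * h)" by (simp only: mult.assoc)
  finally have gd: "g * d = d * h" by (simp only: dph)
  show thesis
  proof (rule that)
    show "star (d * a * g) = d * a * g" by (metis g(1,2) q star_mult)
    show "star (a * d * h) = a * d * h" by (metis h(1,2) p star_mult)
  qed (fact g h(2) qgd dph gd)+
qed

text \<open>Self-adjointness of \<open>a * d\<close> yields a group inverse \<open>h\<close> of it;
  since \<open>d\<close> is a left multiple of \<open>a * d\<close>, this \<open>h\<close> is a
  right witness.\<close>

lemma left_imp_right_invertible_along:
  assumes p: "star (a * d) = a * d" and "left_invertible_along a d"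
  shows "right_invertible_along a d"
proof -
  from assms(2) obtain y where y: "y * d * a * d = d"
    unfolding left_invertible_along_iff by blast
  have "(a * y * y * d) * (a * d) * (a * d) = a * y * (y * d * a * d) * a * d"
    by (simp only: mult.assoc)
  also have "\<dots> = a * y * d * a * d" by (simp only: y)
  also have "\<dots> = a * (y * d * a * d)" by (simp only: mult.assoc)
  also have "\<dots> = a * d" by (simp only: y)
  finally have l: "(a * y * y * d) * (a * d) * (a * d) = a * d" .
  have "(a * d) * ((a * d) * star (a * y * y * d)) = a * d"
    using arg_cong[OF l, of star] by (simp only: star_mult[of _ "a * d"] p)
  then have "(a * d) * (a * d) * star (a * y * y * d) = a * d"
    by (simp only: mult.assoc)
  then obtain h where h: "a * d * h = h * (a * d)" "a * d * h * (a * d) = a * d"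
    using selfadjoint_group_inverse[OF p] by metis
  have "d * a * d * h = y * d * a * d * a * d * h" by (simp only: y)
  also have "\<dots> = y * d * (a * d * (a * d * h))" by (simp only: mult.assoc)
  also have "\<dots> = y * d * (a * d * (h * (a * d)))" by (simp only: h(1))
  also have "\<dots> = y * d * (a * d * h * (a * d))" by (simp only: mult.assoc)
  also have "\<dots> = y * d * (a * d)" by (simp only: h(2))
  also have "\<dots> = y * d * a * d" by (simp only: mult.assoc)
  also have "\<dots> = d" by (fact y)
  finally show ?thesis unfolding right_invertible_along_iff by blast
qed

lemma right_imp_invertible_along:
  assumes "star (a * d) = a * d" and "star (d * a) = d * a"
    and r: "right_invertible_along a d"
  shows "invertible_along a d"
proof -
  obtain g where "d * a * g = g * (d * a)" "d * a * g * d = d"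
    by (rule right_invertible_along_selfadjoint[OF assms])
  \<comment> \<open>\<open>g\<close> commutes with \<open>d * a\<close>, so it serves as the left
    witness.\<close>
  then have "g * d * a * d = d" by (simp only: mult.assoc)
  then show ?thesis
    using r unfolding invertible_along_iff left_invertible_along_iff by blast
qed

lemma right_imp_moore_penrose_invertible:
  assumes "star (a * d) = a * d" and "star (d * a) = d * a"
    and "right_invertible_along a d"
  shows "moore_penrose_invertible d"
proof -
  obtain g h where gh: "star (d * a * g) = d * a * g" "star (a * d * h) = a * d * h"
      "g * (d * a) * g = g" "d * a * g * d = d" "g * d = d * h"
    by (rule right_invertible_along_selfadjoint[OF assms])
  have "d * (a * g) * d = d" using gh(4) by (simp only: mult.assoc)
  moreover have "a * g * d * (a * g) = a * g"
    using arg_cong[OF gh(3), of "\<lambda>z. a * z"] by (simp only: mult.assoc)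
  moreover have "star (d * (a * g)) = d * (a * g)" using gh(1) by (simp only: mult.assoc)
  \<comment> \<open>\<open>g * d = d * h\<close> turns \<open>a * g * d\<close> into the
    self-adjoint \<open>a * d * h\<close>.\<close>
  moreover have "star (a * g * d) = a * g * d" using gh(2,5) by (simp only: mult.assoc)
  ultimately show ?thesis unfolding moore_penrose_invertible_def by blast
qed

end

section \<open>Invertibility of powers along \<open>d\<close>\<close>

context monoid_mult
begin

lemma mult_power_shift: "(d * a) ^ n * d = d * (a * d) ^ n"
  by (rule power_intertwine) (simp only: mult.assoc)

text \<open>As \<open>k\<close> is positive, one factor \<open>a * d\<close> splits off in front;
  the rest of the power joins the witness.\<close>

lemma right_invertible_along_powerD:
  assumes "right_invertible_along ((a * d) ^ k) d" and "k \<ge> 1"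
  shows "right_invertible_along a d"
proof -
  from \<open>k \<ge> 1\<close> obtain m where k: "k = Suc m" by (cases k) auto
  from assms(1) show ?thesis
    unfolding right_invertible_along_iff k power_Suc by (metis mult.assoc)
qed

lemma left_invertible_along_powerD:
  assumes "left_invertible_along ((d * a) ^ k) d" and "k \<ge> 1"
  shows "left_invertible_along a d"
proof -
  from \<open>k \<ge> 1\<close> obtain m where k: "k = Suc m" by (cases k) auto
  from assms(1) show ?thesis
    unfolding left_invertible_along_iff k power_Suc2 by (metis mult.assoc)
qed

end

context star_monoid
begin

text \<open>
  The point is that \<open>d (a d)\<^sup>k d = (d a)\<^sup>k d\<^sup>2\<close> and \<open>d (d a)\<^sup>k d = d\<^sup>2 (a d)\<^sup>k\<close>.
\<close>

lemma power_invertible_along_iff: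
  assumes "star (a * d) = a * d" and "star (d * a) = d * a"
    and "right_invertible_along a d"
  shows "right_invertible_along ((a * d) ^ k) d \<longleftrightarrow> (\<exists>u. d * d * u = d)"
    and "left_invertible_along ((a * d) ^ k) d \<longleftrightarrow> (\<exists>v. v * d * d = d)"
    and "right_invertible_along ((d * a) ^ k) d \<longleftrightarrow> (\<exists>u. d * d * u = d)"
    and "left_invertible_along ((d * a) ^ k) d \<longleftrightarrow> (\<exists>v. v * d * d = d)"
proof -
  obtain g h where gh: "d * a * g = g * (d * a)" "a * d * h = h * (a * d)"
      "d * a * g * d = d" "d * (a * d) * h = d" "g * d = d * h"
    by (rule right_invertible_along_selfadjoint[OF assms])
  \<comment> \<open>\<open>G\<close> and \<open>H\<close> undo \<open>Q\<close> and \<open>P\<close>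
    next to \<open>d\<close>, as \<open>GQ\<close>, \<open>QG\<close>, \<open>HP\<close> and
    \<open>PH\<close> make precise.\<close>
  define G H P Q where "G = g ^ k" and "H = h ^ k" and "P = (a * d) ^ k" and "Q = (d * a) ^ k"
  have qd: "d * a * d = d * (a * d)" by (simp only: mult.assoc)
  have GD: "G * d = d * H" unfolding G_def H_def by (rule power_intertwine[OF gh(5)])
  have QD: "Q * d = d * P" unfolding Q_def P_def by (rule mult_power_shift)
  have GQ: "G * Q * d = d" unfolding G_def Q_def
    by (rule power_cancel[OF qd]) (use gh(1,3) in simp)
  have QG: "Q * G * d = d" unfolding G_def Q_def
    by (rule power_cancel[OF gh(5) gh(3)])
  have HP: "d * H * P = d" using GQ by (metis GD QD mult.assoc)
  have PH: "d * P * H = d" using QG by (metis GD QD mult.assoc)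
  show "right_invertible_along ((a * d) ^ k) d \<longleftrightarrow> (\<exists>u. d * d * u = d)"
    unfolding right_invertible_along_iff P_def[symmetric]
  proof
    assume "\<exists>x. d * P * d * x = d"
    then obtain x where "Q * (d * d * x) = d" by (metis QD mult.assoc)
    \<comment> \<open>Cancelling \<open>Q\<close> leaves \<open>d * d * x = d * H\<close>; a factor
      \<open>P\<close> on the right then restores \<open>d\<close>.\<close>
    then have "G * Q * d * (d * x) = G * d" by (simp only: mult.assoc)
    then have "d * (d * x) = d * H" by (simp only: GQ GD)
    then have "d * d * (x * P) = d" using HP by (metis mult.assoc)
    then show "\<exists>u. d * d * u = d" ..
  next
    assume "\<exists>u. d * d * u = d"
    then obtain u where "d * d * u = d" ..
    \<comment> \<open>\<open>d * P * d * u * H = Q * d * d * u * H = Q * d * H = Q * G *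
      d\<close>.\<close>
    then have "d * P * d * (u * H) = d" by (metis GD QD QG mult.assoc)
    then show "\<exists>x. d * P * d * x = d" ..
  qed
  show "left_invertible_along ((a * d) ^ k) d \<longleftrightarrow> (\<exists>v. v * d * d = d)"
    unfolding left_invertible_along_iff P_def[symmetric]
  proof
    assume "\<exists>y. y * d * P * d = d"
    then show "\<exists>v. v * d * d = d" by (metis QD mult.assoc)
  next
    assume "\<exists>v. v * d * d = d"
    then obtain v where "v * d * d = d" ..
    then have "v * G * d * P * d = d" by (metis GQ QD mult.assoc)
    then show "\<exists>y. y * d * P * d = d" ..
  qed
  show "right_invertible_along ((d * a) ^ k) d \<longleftrightarrow> (\<exists>u. d * d * u = d)"
    unfolding right_invertible_along_iff Q_def[symmetric]
  proof
    assume "\<exists>x. d * Q * d * x = d"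
    then show "\<exists>u. d * d * u = d" by (metis QD mult.assoc)
  next
    assume "\<exists>u. d * d * u = d"
    then obtain u where "d * d * u = d" ..
    then have "d * Q * d * (H * u) = d" by (metis PH QD mult.assoc)
    then show "\<exists>x. d * Q * d * x = d" ..
  qed
  show "left_invertible_along ((d * a) ^ k) d \<longleftrightarrow> (\<exists>v. v * d * d = d)"
    unfolding left_invertible_along_iff Q_def[symmetric]
  proof
    assume "\<exists>y. y * d * Q * d = d"
    then obtain y where "y * d * d * P = d" by (metis QD mult.assoc)
    \<comment> \<open>Mirror of the first case: \<open>H\<close> cancels \<open>P\<close>,
      \<open>d * H\<close> becomes \<open>G * d\<close>, and \<open>Q\<close> removes
      \<open>G\<close>.\<close>
    then have "y * d * (d * P * H) = d * H" by (simp only: mult.assoc[symmetric])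
    then have "y * d * d = d * H" by (simp only: PH)
    then have "(Q * y) * d * d = d" by (metis GD QG mult.assoc)
    then show "\<exists>v. v * d * d = d" ..
  next
    assume "\<exists>v. v * d * d = d"
    then obtain v where "v * d * d = d" ..
    then have "G * v * d * Q * d = d" by (metis GQ QD mult.assoc)
    then show "\<exists>y. y * d * Q * d = d" ..
  qed
qed

end

theorem theorem5p6:
  fixes a d :: "'a::star_monoid" and k :: nat
  assumes "star (a * d) = a * d"
    and "star (d * a) = d * a"
    and "k \<ge> 1"
  shows "((invertible_along a d \<and> group_invertible d) \<longleftrightarrow>
      (invertible_along a d \<and> group_invertible d \<and> moore_penrose_invertible d)) \<and>
    ((invertible_along a d \<and> group_invertible d) \<longleftrightarrow>
      (right_invertible_along ((a * d) ^ k) d \<and> left_invertible_along ((d * a) ^ k) d)) \<and>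
    ((invertible_along a d \<and> group_invertible d) \<longleftrightarrow>
      (invertible_along ((a * d) ^ k) d)) \<and>
    ((invertible_along a d \<and> group_invertible d) \<longleftrightarrow>
      (invertible_along ((d * a) ^ k) d))"
proof -
  let ?A = "right_invertible_along a d"
  have inv: "invertible_along a d \<longleftrightarrow> ?A"
    using right_imp_invertible_along[OF assms(1,2)] invertible_along_iff by blast
  \<comment> \<open>Conditions (3) and (4) contain the premise of \<open>A_ad\<close>, and (5) that
    of \<open>A_da\<close>. So \<open>?A\<close> holds under every condition and
    \<open>powers\<close> applies.\<close>
  have A_ad: "?A" if "right_invertible_along ((a * d) ^ k) d"
    using that assms(3) by (rule right_invertible_along_powerD)
  have A_da: "?A" if "left_invertible_along ((d * a) ^ k) d"
    using left_imp_right_invertible_along[OF assms(1)]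
      left_invertible_along_powerD[OF that assms(3)] by blast
  note powers = power_invertible_along_iff[OF assms(1,2), of k]
  show ?thesis
    using right_imp_moore_penrose_invertible[OF assms(1,2)] A_ad A_da powers
    unfolding inv invertible_along_iff[of "_ ^ k"] group_invertible_iff by blast
qed

end
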